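(* Let $G$ and $H$ be two nontrivial and connected graphs. The strong product $G\boxtimes H$ is well-edge-dominated if and only if both $G$ and $H$ consist of a single edge (i.e., both are isomorphic to $K_2$).
   Context: All graphs are finite and simple. A graph is trivial if it has exactly one vertex; nontrivial graphs have at least two vertices. Two edges are adjacent if they share an endpoint. An edge subset $F$ of a graph $G$ is an edge dominating set if every edge not in $F$ is adjacent to at least one edge in $F$. A graph is well-edge-dominated if all its (inclusion-wise) minimal edge dominating sets are minimum, i.e., of smallest cardinality among all edge dominating sets. The strong product $G\boxtimes H$ has vertex set $V(G)\times V(H)$, and two distinct vertices $(u_1,v_1)$ and $(u_2,v_2)$ are adjacent if and only if $u_2\in N_G[u_1]$ and $v_2\in N_H[v_1]$, where $N_G[v]$ denotes the closed neighborhood of $v$ in $G$ (the vertex $v$ together with its neighbors). *)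

theory Defs
  imports Main
begin

record 'a ugraph =
  verts :: "'a set"
  edges :: "'a set set"

text \<open>Finite simple undirected graphs; an edge is the two-element set of its endpoints.\<close>

definition simple_graph :: "'a ugraph \<Rightarrow> bool" where
  "simple_graph G \<longleftrightarrow>
     finite (verts G) \<and> (\<forall>e\<in>edges G. e \<subseteq> verts G \<and> card e = 2)"

definition nontrivial :: "'a ugraph \<Rightarrow> bool" where
  "nontrivial G \<longleftrightarrow> card (verts G) \<ge> 2"

definition vertex_adj :: "'a ugraph \<Rightarrow> 'a \<Rightarrow> 'a \<Rightarrow> bool" where
  "vertex_adj G u v \<longleftrightarrow> {u, v} \<in> edges G"

definition connected_graph :: "'a ugraph \<Rightarrow> bool" where
  "connected_graph G \<longleftrightarrow>
     verts G \<noteq> {} \<and> (\<forall>u\<in>verts G. \<forall>v\<in>verts G. (vertex_adj G)\<^sup>*\<^sup>* u v)"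

definition closed_nbhd :: "'a ugraph \<Rightarrow> 'a \<Rightarrow> 'a set" where
  "closed_nbhd G v = insert v {u \<in> verts G. vertex_adj G v u}"

definition strong_product :: "'a ugraph \<Rightarrow> 'b ugraph \<Rightarrow> ('a \<times> 'b) ugraph"
    (infixl "\<boxtimes>" 70) where
  "G \<boxtimes> H =
     \<lparr> verts = verts G \<times> verts H,
       edges = {{(u1, v1), (u2, v2)} | u1 v1 u2 v2.
                  (u1, v1) \<in> verts G \<times> verts H \<and> (u2, v2) \<in> verts G \<times> verts H \<and>
                  (u1, v1) \<noteq> (u2, v2) \<and>
                  u2 \<in> closed_nbhd G u1 \<and> v2 \<in> closed_nbhd H v1} \<rparr>"

definition edge_adj :: "'a set \<Rightarrow> 'a set \<Rightarrow> bool" where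
  "edge_adj e f \<longleftrightarrow> e \<noteq> f \<and> e \<inter> f \<noteq> {}"

definition edge_dominating :: "'a ugraph \<Rightarrow> 'a set set \<Rightarrow> bool" where
  "edge_dominating G F \<longleftrightarrow>
     F \<subseteq> edges G \<and> (\<forall>e \<in> edges G - F. \<exists>f\<in>F. edge_adj e f)"

definition minimal_edge_dominating :: "'a ugraph \<Rightarrow> 'a set set \<Rightarrow> bool" where
  "minimal_edge_dominating G F \<longleftrightarrow>
     edge_dominating G F \<and> (\<forall>F'. F' \<subset> F \<longrightarrow> \<not> edge_dominating G F')"

definition minimum_edge_dominating :: "'a ugraph \<Rightarrow> 'a set set \<Rightarrow> bool" where
  "minimum_edge_dominating G F \<longleftrightarrow>
     edge_dominating G F \<and> (\<forall>F'. edge_dominating G F' \<longrightarrow> card F \<le> card F')"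

definition well_edge_dominated :: "'a ugraph \<Rightarrow> bool" where
  "well_edge_dominated G \<longleftrightarrow>
     (\<forall>F. minimal_edge_dominating G F \<longrightarrow> minimum_edge_dominating G F)"

definition graph_isomorphic :: "'a ugraph \<Rightarrow> 'b ugraph \<Rightarrow> bool" (infix "\<simeq>" 50) where
  "G \<simeq> H \<longleftrightarrow>
     (\<exists>f. bij_betw f (verts G) (verts H) \<and>
        (\<forall>u\<in>verts G. \<forall>v\<in>verts G. vertex_adj G u v \<longleftrightarrow> vertex_adj H (f u) (f v)))"

definition K2 :: "nat ugraph" where
  "K2 = \<lparr> verts = {0, 1}, edges = {{0, 1}} \<rparr>"

lemma simple_graph_K2: "simple_graph K2"
  by (simp add: simple_graph_def K2_def)

lemma simple_graph_strong_product:
  assumes "simple_graph G" "simple_graph H"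
  shows "simple_graph (G \<boxtimes> H)"
  using assms by (auto simp: simple_graph_def strong_product_def card_insert_if)

lemma vertex_adj_strong_product:
  assumes "(u1, v1) \<in> verts G \<times> verts H" "(u2, v2) \<in> verts G \<times> verts H"
  shows "vertex_adj (G \<boxtimes> H) (u1, v1) (u2, v2) \<longleftrightarrow>
           (u1, v1) \<noteq> (u2, v2) \<and> u2 \<in> closed_nbhd G u1 \<and> v2 \<in> closed_nbhd H v1"
  using assms
  by (auto simp: vertex_adj_def strong_product_def closed_nbhd_def doubleton_eq_iff insert_commute)

end

theory Submission
  imports Defs
begin

text \<open>
  Whether a set \<open>F\<close> of edges dominates depends only on the set \<open>\<Union>F\<close> of vertices that it covers: every
  edge has to meet it. If the endpoints of an edge \<open>e\<close> are deleted from a graph, then adding \<open>e\<close>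
  turns (minimal) edge dominating sets of the smaller graph into (minimal) edge dominating sets of
  the larger one, so being well-edge-dominated is inherited
  (\<open>well_edge_dominated_delete_edge_endpoints\<close>).

  The obstruction is a pair of four-cliques \<open>{y0, y1, x0, x1}\<close> and \<open>{y0, y1, z0, z1}\<close> sharing the edge
  \<open>{y0, y1}\<close>. After the endpoints of edges that avoid these six vertices have been deleted one edge
  at a time, the vertices outside of the six are independent, so the three disjoint edges
  \<open>{x0, x1}\<close>, \<open>{y0, y1}\<close>, \<open>{z0, z1}\<close> form a minimal edge dominating set. A minimal edge dominating
  set of size four always exists too (\<open>overlapping_cliques_covering_not_well_edge_dominated\<close>), hence
  no graph with this configuration is well-edge-dominated.

  A connected graph with at least three vertices has a vertex \<open>y\<close> with two neighbours \<open>x\<close> and \<open>z\<close>, and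
  the strong product of the path \<open>x\<close>, \<open>y\<close>, \<open>z\<close> with an edge contains these two cliques. So both
  factors have exactly two vertices. Conversely, the strong product of two edges is the complete
  graph on four vertices, in which the edge dominating sets are exactly the sets of at least two
  edges.
\<close>

section \<open>Edge domination in terms of covered vertices\<close>

lemma simple_graph_edge_not_empty:
  "simple_graph G \<Longrightarrow> e \<in> edges G \<Longrightarrow> e \<noteq> {}"
  by (auto simp: simple_graph_def)

lemma simple_graph_finite_edges:
  assumes "simple_graph G"
  shows "finite (edges G)"
proof (rule finite_subset)
  show "edges G \<subseteq> Pow (verts G)"
    using assms by (auto simp: simple_graph_def)
  show "finite (Pow (verts G))"
    using assms by (simp add: simple_graph_def)
qed

lemma edge_dominating_iff:
  assumes "simple_graph G"
  shows "edge_dominating G F \<longleftrightarrow> F \<subseteq> edges G \<and> (\<forall>e\<in>edges G. e \<inter> \<Union>F \<noteq> {})"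
proof -
  have "(\<forall>e\<in>edges G - F. \<exists>f\<in>F. edge_adj e f) \<longleftrightarrow> (\<forall>e\<in>edges G. e \<inter> \<Union>F \<noteq> {})"
  proof (intro iffI ballI)
    fix e assume *: "\<forall>e\<in>edges G - F. \<exists>f\<in>F. edge_adj e f" and e: "e \<in> edges G"
    show "e \<inter> \<Union>F \<noteq> {}"
    proof (cases "e \<in> F")
      case True
      with simple_graph_edge_not_empty[OF assms e] show ?thesis by blast
    next
      case False
      with * e obtain f where "f \<in> F" "edge_adj e f" by blast
      then show ?thesis by (auto simp: edge_adj_def)
    qed
  next
    fix e assume *: "\<forall>e\<in>edges G. e \<inter> \<Union>F \<noteq> {}" and e: "e \<in> edges G - F"
    then obtain f where "f \<in> F" "e \<inter> f \<noteq> {}" by blast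
    with e show "\<exists>f\<in>F. edge_adj e f" by (auto simp: edge_adj_def)
  qed
  then show ?thesis by (auto simp: edge_dominating_def)
qed

text \<open>
  Supersets of edge dominating sets are edge dominating, so minimality only has to be tested on the
  removal of single edges; each edge needs a private witness that the others leave untouched.
\<close>

lemma minimal_edge_dominating_iff:
  assumes "simple_graph G"
  shows "minimal_edge_dominating G F \<longleftrightarrow>
    F \<subseteq> edges G \<and> (\<forall>e\<in>edges G. e \<inter> \<Union>F \<noteq> {}) \<and>
    (\<forall>f\<in>F. \<exists>e\<in>edges G. e \<inter> \<Union>(F - {f}) = {})"
    (is "_ \<longleftrightarrow> ?sub \<and> ?dom \<and> ?priv")
proof -
  have "?priv \<longleftrightarrow> (\<forall>F'. F' \<subset> F \<longrightarrow> \<not> edge_dominating G F')" if sub: ?sub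
  proof (intro iffI ballI allI impI)
    fix F' assume priv: ?priv and "F' \<subset> F"
    then obtain f where f: "f \<in> F" "F' \<subseteq> F - {f}" by blast
    with priv obtain e where "e \<in> edges G" "e \<inter> \<Union>(F - {f}) = {}" by blast
    with f show "\<not> edge_dominating G F'"
      unfolding edge_dominating_iff[OF assms] by blast
  next
    fix f assume "\<forall>F'. F' \<subset> F \<longrightarrow> \<not> edge_dominating G F'" "f \<in> F"
    then have "\<not> edge_dominating G (F - {f})" by blast
    with sub show "\<exists>e\<in>edges G. e \<inter> \<Union>(F - {f}) = {}"
      unfolding edge_dominating_iff[OF assms] by blast
  qed
  then show ?thesis
    by (simp only: minimal_edge_dominating_def edge_dominating_iff[OF assms, of F] conj_assoc
        cong: conj_cong)
qed

text \<open>An edge of a matching is its own private witness.\<close>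

lemma maximal_matching_minimal_edge_dominating:
  assumes "simple_graph G" "M \<subseteq> edges G" "pairwise disjnt M" "\<forall>e\<in>edges G. e \<inter> \<Union>M \<noteq> {}"
  shows "minimal_edge_dominating G M"
proof -
  have "\<exists>e\<in>edges G. e \<inter> \<Union>(M - {f}) = {}" if "f \<in> M" for f
    using that assms(2,3) by (intro bexI[of _ f]) (auto simp: pairwise_def disjnt_def)
  with assms(2,4) show ?thesis
    unfolding minimal_edge_dominating_iff[OF assms(1)] by (intro conjI ballI) auto
qed

lemma minimal_edge_dominating_card_eq:
  assumes "well_edge_dominated G" "minimal_edge_dominating G F" "minimal_edge_dominating G F'"
  shows "card F = card F'"
  using assms unfolding well_edge_dominated_def minimum_edge_dominating_def
  by (metis le_antisym)

section \<open>Deleting the endpoints of an edge\<close>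

definition delete_vertices :: "'a ugraph \<Rightarrow> 'a set \<Rightarrow> 'a ugraph" where
  "delete_vertices G X = \<lparr> verts = verts G - X, edges = {e \<in> edges G. e \<inter> X = {}} \<rparr>"

lemma edges_delete_vertices: "edges (delete_vertices G X) = {e \<in> edges G. e \<inter> X = {}}"
  by (simp add: delete_vertices_def)

lemma simple_graph_delete_vertices: "simple_graph G \<Longrightarrow> simple_graph (delete_vertices G X)"
  by (auto simp: simple_graph_def delete_vertices_def)

text \<open>
  Adding \<open>e\<close> back costs one edge for every set of edges of the smaller graph, and it preserves
  minimality: \<open>e\<close> is its own private witness, and the old witnesses do not meet \<open>e\<close>.
\<close>

lemma well_edge_dominated_delete_edge_endpoints:
  assumes G: "simple_graph G" and wed: "well_edge_dominated G" and e: "e \<in> edges G"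
  shows "well_edge_dominated (delete_vertices G e)"
proof -
  let ?D = "delete_vertices G e"
  note D = simple_graph_delete_vertices[OF G, of e]
  have ne: "e \<noteq> {}" using simple_graph_edge_not_empty[OF G e] .
  have dom: "edge_dominating G (insert e F)" if "edge_dominating ?D F" for F
    using that e
    unfolding edge_dominating_iff[OF G] edge_dominating_iff[OF D] edges_delete_vertices by blast
  have card: "card (insert e F) = Suc (card F)" if "edge_dominating ?D F" for F
  proof -
    have "F \<subseteq> edges ?D" using that by (simp add: edge_dominating_def)
    with simple_graph_finite_edges[OF D] ne show ?thesis
      by (subst card_insert_disjoint) (auto intro: finite_subset simp: edges_delete_vertices)
  qed
  have "minimum_edge_dominating ?D F" if F: "minimal_edge_dominating ?D F" for F
  proof -
    have Fdom: "edge_dominating ?D F" using F by (simp add: minimal_edge_dominating_def)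
    have sub: "F \<subseteq> edges ?D" using Fdom by (simp add: edge_dominating_def)
    have witness: "\<exists>h\<in>edges G. h \<inter> \<Union>(insert e F - {f}) = {}" if f: "f \<in> insert e F" for f
    proof (cases "f = e")
      case True
      with sub e show ?thesis
        by (intro bexI[of _ e]) (auto simp: edges_delete_vertices)
    next
      case False
      then have "f \<in> F" using f by simp
      moreover have "\<forall>f\<in>F. \<exists>h\<in>edges ?D. h \<inter> \<Union>(F - {f}) = {}"
        using F unfolding minimal_edge_dominating_iff[OF D] by (elim conjE)
      ultimately obtain h where h: "h \<in> edges ?D" "h \<inter> \<Union>(F - {f}) = {}" by blast
      then show ?thesis
        by (intro bexI[of _ h]) (auto simp: edges_delete_vertices)
    qed
    note insert_dom = dom[OF Fdom, unfolded edge_dominating_iff[OF G]]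
    have "minimal_edge_dominating G (insert e F)"
      unfolding minimal_edge_dominating_iff[OF G]
      by (intro conjI insert_dom[THEN conjunct1] insert_dom[THEN conjunct2] ballI[OF witness])
    then have min: "minimum_edge_dominating G (insert e F)"
      using wed by (simp add: well_edge_dominated_def)
    have "card F \<le> card F'" if F': "edge_dominating ?D F'" for F'
    proof -
      have "card (insert e F) \<le> card (insert e F')"
        using min dom[OF F'] by (simp add: minimum_edge_dominating_def)
      then show ?thesis by (simp add: card[OF Fdom] card[OF F'])
    qed
    with Fdom show ?thesis by (simp add: minimum_edge_dominating_def)
  qed
  then show ?thesis by (simp add: well_edge_dominated_def)
qed

section \<open>Two four-cliques sharing an edge\<close>

text \<open>
  The vertices outside of the two cliques are independent here. If one of \<open>y0\<close>, \<open>y1\<close> has no outside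
  neighbour, it can be left uncovered while the star at the other one reaches the four vertices
  \<open>x0\<close>, \<open>x1\<close>, \<open>z0\<close>, \<open>z1\<close>; each leaf is a neighbour of the uncovered vertex, so no edge of the star
  can be spared. If \<open>y0\<close> and \<open>y1\<close> have different outside neighbours, there is a
  maximal matching of size four. In the
  remaining case they have the same single outside neighbour \<open>w\<close>, and the star from \<open>y1\<close> to \<open>w\<close>,
  \<open>x0\<close>, \<open>x1\<close>, together with \<open>{z0, z1}\<close>, covers all of the six vertices except \<open>y0\<close>, whose only
  outside neighbour is covered as well; so the uncovered vertices are again independent.
\<close>

lemma overlapping_cliques_covering_not_well_edge_dominated:
  assumes G: "simple_graph G"
    and dist: "distinct [x0, x1, y0, y1, z0, z1]"
    and edges: "{x0, x1} \<in> edges G" "{y0, y1} \<in> edges G" "{z0, z1} \<in> edges G"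
      "{y0, x0} \<in> edges G" "{y0, x1} \<in> edges G" "{y0, z0} \<in> edges G" "{y0, z1} \<in> edges G"
      "{y1, x0} \<in> edges G" "{y1, x1} \<in> edges G" "{y1, z0} \<in> edges G" "{y1, z1} \<in> edges G"
    and cover: "\<forall>e\<in>edges G. e \<inter> {x0, x1, y0, y1, z0, z1} \<noteq> {}"
  shows "\<not> well_edge_dominated G"
proof
  assume wed: "well_edge_dominated G"
  let ?S = "{x0, x1, y0, y1, z0, z1}"
  have pair: "\<exists>u v. e = {u, v} \<and> u \<noteq> v" if "e \<in> edges G" for e
    using that G by (auto simp: simple_graph_def card_2_iff)
  have three: "minimal_edge_dominating G {{x0, x1}, {y0, y1}, {z0, z1}}"
    by (rule maximal_matching_minimal_edge_dominating[OF G])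
      (use edges cover dist in \<open>auto simp: pairwise_insert disjnt_def\<close>)
  have size: "card F = 3" if "minimal_edge_dominating G F" for F
  proof -
    have "card F = card {{x0, x1}, {y0, y1}, {z0, z1}}"
      using wed that three by (rule minimal_edge_dominating_card_eq)
    also have "\<dots> = 3" using dist by (simp add: doubleton_eq_iff)
    finally show ?thesis .
  qed
  have outside: "\<exists>w. w \<notin> ?S \<and> {u, w} \<in> edges G"
    if u: "(u, c) = (y0, y1) \<or> (u, c) = (y1, y0)" for u c
  proof (rule ccontr)
    assume none: "\<not> ?thesis"
    let ?F = "{{c, x0}, {c, x1}, {c, z0}, {c, z1}}"
    have covered: "e \<inter> \<Union>?F \<noteq> {}" if e: "e \<in> edges G" for e
    proof (cases "u \<in> e")
      case True
      with pair[OF e] obtain v where "e = {u, v}" "u \<noteq> v" by (metis insert_commute insertE singletonD)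
      with none e u show ?thesis by (auto simp: insert_commute)
    next
      case False
      with cover e u show ?thesis by auto
    qed
    \<comment> \<open>Once the leaf \<open>l\<close> is dropped, the edge from \<open>l\<close> to the uncovered vertex \<open>u\<close> is undominated.\<close>
    have "\<exists>e\<in>edges G. e \<inter> \<Union>(?F - {f}) = {}" if f: "f \<in> ?F" for f
    proof -
      from f obtain l where l: "f = {c, l}" "l \<in> {x0, x1, z0, z1}" by auto
      have "{u, l} \<in> edges G" using l u edges by auto
      moreover have "{u, l} \<inter> \<Union>(?F - {f}) = {}" using l u dist by (auto simp: doubleton_eq_iff)
      ultimately show ?thesis by blast
    qed
    then have "minimal_edge_dominating G ?F"
      unfolding minimal_edge_dominating_iff[OF G] using covered edges u by auto
    moreover have "card ?F = 4" using dist u by (auto simp: doubleton_eq_iff)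
    ultimately show False using size[of ?F] by simp
  qed
  obtain w0 where w0: "w0 \<notin> ?S" "{y0, w0} \<in> edges G"
    using outside[of y0 y1] by blast
  obtain w1 where w1: "w1 \<notin> ?S" "{y1, w1} \<in> edges G"
    using outside[of y1 y0] by blast
  \<comment> \<open>Two applications with the same \<open>w'\<close> show that the outside neighbour of \<open>y0\<close> is unique.\<close>
  have same: "w = w'"
    if w: "w \<notin> ?S" "{y0, w} \<in> edges G" and w': "w' \<notin> ?S" "{y1, w'} \<in> edges G" for w w'
  proof (rule ccontr)
    assume neq: "w \<noteq> w'"
    let ?F = "{{y0, w}, {y1, w'}, {x0, x1}, {z0, z1}}"
    have "minimal_edge_dominating G ?F"
      by (rule maximal_matching_minimal_edge_dominating[OF G])
        (use edges cover dist w w' neq in \<open>auto simp: pairwise_insert disjnt_def\<close>)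
    moreover have "card ?F = 4" using dist w w' neq by (auto simp: doubleton_eq_iff)
    ultimately show False using size[of ?F] by simp
  qed
  define w where "w = w1"
  have w: "w \<notin> ?S" "{y0, w} \<in> edges G" "{y1, w} \<in> edges G"
    using same[OF w0 w1] w0 w1 by (auto simp: w_def)
  let ?F = "{{y1, w}, {y1, x0}, {y1, x1}, {z0, z1}}"
  have covered: "e \<inter> \<Union>?F \<noteq> {}" if e: "e \<in> edges G" for e
  proof (cases "y0 \<in> e")
    case True
    with pair[OF e] obtain v where v: "e = {y0, v}" "y0 \<noteq> v"
      by (metis insert_commute insertE singletonD)
    then have "v \<in> ?S \<or> v = w" using same[of v w] e w by blast
    with v show ?thesis by auto
  next
    case False
    with cover e show ?thesis by auto
  qed
  have "\<exists>e\<in>edges G. e \<inter> \<Union>(?F - {f}) = {}" if f: "f \<in> ?F" for f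
  proof (cases "f = {z0, z1}")
    case True
    then show ?thesis using edges dist w by (intro bexI[of _ "{z0, z1}"]) auto
  next
    case False
    with f obtain l where l: "f = {y1, l}" "l \<in> {w, x0, x1}" by auto
    have "{y0, l} \<in> edges G" using l w edges by auto
    moreover have "{y0, l} \<inter> \<Union>(?F - {f}) = {}" using l w dist by (auto simp: doubleton_eq_iff)
    ultimately show ?thesis by blast
  qed
  then have "minimal_edge_dominating G ?F"
    unfolding minimal_edge_dominating_iff[OF G] using covered edges w by auto
  moreover have "card ?F = 4" using dist w by (auto simp: doubleton_eq_iff)
  ultimately show False using size[of ?F] by simp
qed

text \<open>
  The endpoints of an edge that avoids the configuration can be deleted without harming either the
  configuration or the property, until the previous lemma applies.
\<close>

lemma overlapping_cliques_not_well_edge_dominated: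
  assumes "simple_graph G"
    and "distinct [x0, x1, y0, y1, z0, z1]"
    and "{x0, x1} \<in> edges G" "{y0, y1} \<in> edges G" "{z0, z1} \<in> edges G"
      "{y0, x0} \<in> edges G" "{y0, x1} \<in> edges G" "{y0, z0} \<in> edges G" "{y0, z1} \<in> edges G"
      "{y1, x0} \<in> edges G" "{y1, x1} \<in> edges G" "{y1, z0} \<in> edges G" "{y1, z1} \<in> edges G"
  shows "\<not> well_edge_dominated G"
  using assms
proof (induction "card (edges G)" arbitrary: G rule: less_induct)
  case less
  let ?S = "{x0, x1, y0, y1, z0, z1}"
  show ?case
  proof (cases "\<forall>e\<in>edges G. e \<inter> ?S \<noteq> {}")
    case True
    show ?thesis
      by (rule overlapping_cliques_covering_not_well_edge_dominated[OF less.prems True])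
  next
    case False
    then obtain e where e: "e \<in> edges G" "e \<inter> ?S = {}" by blast
    let ?D = "delete_vertices G e"
    have "edges ?D \<subset> edges G"
      using e simple_graph_edge_not_empty[OF less.prems(1) e(1)]
      by (auto simp: edges_delete_vertices)
    then have "card (edges ?D) < card (edges G)"
      using simple_graph_finite_edges[OF less.prems(1)] by (rule psubset_card_mono[rotated])
    then have "\<not> well_edge_dominated ?D"
      by (rule less.hyps)
        (use less.prems e simple_graph_delete_vertices[of G e]
          in \<open>auto simp: edges_delete_vertices\<close>)
    with well_edge_dominated_delete_edge_endpoints[OF less.prems(1) _ e(1)] show ?thesis by blast
  qed
qed

section \<open>Connected graphs and their strong products\<close>

lemma vertex_adj_sym: "vertex_adj G u v \<longleftrightarrow> vertex_adj G v u"
  by (simp add: vertex_adj_def insert_commute)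

lemma vertex_adjD:
  assumes "simple_graph G" "vertex_adj G u v"
  shows "u \<in> verts G" "v \<in> verts G" "u \<noteq> v"
  using assms by (force simp: simple_graph_def vertex_adj_def)+

text \<open>
  A set containing some but not all vertices is left by some edge, since otherwise no path could
  leave it.
\<close>

lemma connected_graph_leaving_edge:
  assumes "connected_graph G" "u \<in> X" "u \<in> verts G" "v \<in> verts G" "v \<notin> X"
  shows "\<exists>a b. a \<in> X \<and> b \<notin> X \<and> vertex_adj G a b"
proof (rule ccontr)
  assume closed: "\<not> ?thesis"
  have "(vertex_adj G)\<^sup>*\<^sup>* u v" using assms by (simp add: connected_graph_def)
  then have "v \<in> X"
    by (induction rule: rtranclp_induct) (use closed assms(2) in blast)+
  with assms(5) show False by simp
qed

lemma nontrivial_connected_graph_has_edge: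
  assumes "nontrivial G" "connected_graph G"
  shows "\<exists>a b. vertex_adj G a b"
proof -
  obtain u where u: "u \<in> verts G" using assms(2) by (auto simp: connected_graph_def)
  have "verts G \<noteq> {u}" using assms(1) by (auto simp: nontrivial_def)
  with u obtain v where "v \<in> verts G" "v \<noteq> u" by blast
  then show ?thesis using connected_graph_leaving_edge[OF assms(2), of u "{u}" v] u by auto
qed

lemma connected_graph_has_path:
  assumes G: "simple_graph G" "nontrivial G" "connected_graph G" and "card (verts G) \<noteq> 2"
  shows "\<exists>x y z. vertex_adj G y x \<and> vertex_adj G y z \<and> x \<noteq> z"
proof -
  obtain a b where ab: "vertex_adj G a b"
    using nontrivial_connected_graph_has_edge[OF G(2,3)] by blast
  note * = vertex_adjD[OF G(1) ab]
  have "verts G \<noteq> {a, b}" using assms(4) *(3) by auto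
  with * obtain v where "v \<in> verts G" "v \<notin> {a, b}" by blast
  then obtain c d where "c \<in> {a, b}" "d \<notin> {a, b}" "vertex_adj G c d"
    using connected_graph_leaving_edge[OF G(3), of a "{a, b}" v] * by blast
  with ab show ?thesis using vertex_adj_sym[of G a b] by blast
qed

lemma isomorphic_K2_iff:
  assumes G: "simple_graph G" "nontrivial G" "connected_graph G"
  shows "G \<simeq> K2 \<longleftrightarrow> card (verts G) = 2"
proof
  assume "G \<simeq> K2"
  then have "card (verts G) = card (verts K2)"
    by (auto simp: graph_isomorphic_def dest: bij_betw_same_card)
  then show "card (verts G) = 2" by (simp add: K2_def)
next
  assume card: "card (verts G) = 2"
  obtain a b where ab: "vertex_adj G a b"
    using nontrivial_connected_graph_has_edge[OF G(2,3)] by blast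
  note * = vertex_adjD[OF G(1) ab]
  have "finite (verts G)" using G(1) by (simp add: simple_graph_def)
  then have V: "verts G = {a, b}"
    using card_subset_eq[of "verts G" "{a, b}"] * card by auto
  define f where "f = (\<lambda>v. if v = a then 0 else 1 :: nat)"
  have "bij_betw f (verts G) (verts K2)"
    using *(3) by (auto simp: V K2_def f_def bij_betw_def inj_on_def)
  moreover have "vertex_adj G u v \<longleftrightarrow> vertex_adj K2 (f u) (f v)"
    if "u \<in> verts G" "v \<in> verts G" for u v
    using that ab vertex_adj_sym[of G a b] vertex_adjD(3)[OF G(1), of u v] *(3)
    by (auto simp: V f_def K2_def vertex_adj_def doubleton_eq_iff)
  ultimately show "G \<simeq> K2" by (auto simp: graph_isomorphic_def)
qed

lemma strong_product_edgeI:
  assumes "simple_graph G" "simple_graph H"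
    and "(u1 = u2 \<and> u1 \<in> verts G) \<or> vertex_adj G u1 u2"
    and "(v1 = v2 \<and> v1 \<in> verts H) \<or> vertex_adj H v1 v2"
    and "(u1, v1) \<noteq> (u2, v2)"
  shows "{(u1, v1), (u2, v2)} \<in> edges (G \<boxtimes> H)"
proof -
  have "u1 \<in> verts G" "u2 \<in> verts G" "v1 \<in> verts H" "v2 \<in> verts H"
    using assms(3,4) vertex_adjD[OF assms(1), of u1 u2] vertex_adjD[OF assms(2), of v1 v2] by auto
  then show ?thesis
    using assms(3-5) vertex_adj_strong_product[of u1 v1 G H u2 v2]
    by (auto simp: closed_nbhd_def vertex_adj_def)
qed

text \<open>
  The cliques are the products of the edges \<open>{x, y}\<close> and \<open>{y, z}\<close> of a path with an edge of the other
  factor. The two factors play different parts, but the configuration is symmetric under exchange of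
  coordinates.
\<close>

lemma strong_product_path_edge_not_well_edge_dominated:
  assumes G: "simple_graph G" and H: "simple_graph H"
    and path: "vertex_adj G y x" "vertex_adj G y z" "x \<noteq> z" and ab: "vertex_adj H a b"
  shows "\<not> well_edge_dominated (G \<boxtimes> H)"
proof -
  note facts = path ab vertex_adjD[OF G path(1)] vertex_adjD[OF G path(2)] vertex_adjD[OF H ab]
    ab[unfolded vertex_adj_sym[of H a b]]
  show ?thesis
    by (rule overlapping_cliques_not_well_edge_dominated
          [OF simple_graph_strong_product[OF G H],
            of "(x, a)" "(x, b)" "(y, a)" "(y, b)" "(z, a)" "(z, b)"])
      (use facts in \<open>auto intro!: strong_product_edgeI[OF G H]\<close>)
qed

lemma strong_product_edge_path_not_well_edge_dominated:
  assumes G: "simple_graph G" and H: "simple_graph H"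
    and path: "vertex_adj H y x" "vertex_adj H y z" "x \<noteq> z" and ab: "vertex_adj G a b"
  shows "\<not> well_edge_dominated (G \<boxtimes> H)"
proof -
  note facts = path ab vertex_adjD[OF H path(1)] vertex_adjD[OF H path(2)] vertex_adjD[OF G ab]
    ab[unfolded vertex_adj_sym[of G a b]]
  show ?thesis
    by (rule overlapping_cliques_not_well_edge_dominated
          [OF simple_graph_strong_product[OF G H],
            of "(a, x)" "(b, x)" "(a, y)" "(b, y)" "(a, z)" "(b, z)"])
      (use facts in \<open>auto intro!: strong_product_edgeI[OF G H]\<close>)
qed

section \<open>The complete graph on four vertices\<close>

text \<open>
  One edge of a complete graph on four vertices misses the opposite edge, while two different edges
  cover at least three of the four vertices. So every minimal edge dominating set has two elements.
\<close>

lemma complete_four_well_edge_dominated: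
  assumes G: "simple_graph G" and four: "card (verts G) = 4"
    and complete: "\<And>u v. u \<in> verts G \<Longrightarrow> v \<in> verts G \<Longrightarrow> u \<noteq> v \<Longrightarrow> {u, v} \<in> edges G"
  shows "well_edge_dominated G"
proof -
  have finV: "finite (verts G)" using G by (simp add: simple_graph_def)
  have edge: "e \<subseteq> verts G" "card e = 2" "finite e" if "e \<in> edges G" for e
    using that G by (auto simp: simple_graph_def intro: card_ge_0_finite)
  have dominating_card: "2 \<le> card F" if F: "edge_dominating G F" for F
  proof (rule ccontr)
    assume "\<not> 2 \<le> card F"
    have sub: "F \<subseteq> edges G" using F by (simp add: edge_dominating_def)
    have fin: "finite F" using sub simple_graph_finite_edges[OF G] by (rule finite_subset)
    have "card (\<Union>F) \<le> 2"
    proof (cases "F = {}")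
      case False
      then have "card F = 1" using fin \<open>\<not> 2 \<le> card F\<close> card_gt_0_iff[of F] by linarith
      then obtain f where "F = {f}" by (auto simp: card_1_singleton_iff)
      with sub edge(2)[of f] show ?thesis by simp
    qed simp
    moreover have sub': "\<Union>F \<subseteq> verts G" using sub edge(1) by blast
    ultimately have "2 \<le> card (verts G - \<Union>F)"
      using four finV by (simp add: card_Diff_subset finite_subset)
    then obtain T where "T \<subseteq> verts G - \<Union>F" "card T = 2" by (meson obtain_subset_with_card_n)
    then obtain u v where uv: "u \<in> verts G" "v \<in> verts G" "u \<noteq> v" "{u, v} \<inter> \<Union>F = {}"
      by (auto simp: card_2_iff)
    then show False using F complete[OF uv(1-3)] unfolding edge_dominating_iff[OF G] by blast
  qed
  have two_dominate: "edge_dominating G {e, f}"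
    if ef: "e \<in> edges G" "f \<in> edges G" "e \<noteq> f" for e f
  proof -
    have "\<not> f \<subseteq> e"
      using ef edge card_subset_eq[of e f] by auto
    then have "e \<subset> e \<union> f" by blast
    then have "3 \<le> card (e \<union> f)"
      using psubset_card_mono[of "e \<union> f" e] edge ef by auto
    have "h \<inter> \<Union>{e, f} \<noteq> {}" if h: "h \<in> edges G" for h
    proof
      assume "h \<inter> \<Union>{e, f} = {}"
      then have "card (h \<union> (e \<union> f)) = card h + card (e \<union> f)"
        using edge(3) ef h by (intro card_Un_disjoint) auto
      moreover have "card (h \<union> (e \<union> f)) \<le> card (verts G)"
        using edge(1) ef h finV by (intro card_mono) auto
      ultimately show False using \<open>3 \<le> card (e \<union> f)\<close> edge(2)[OF h] four by simp
    qed
    with ef show ?thesis unfolding edge_dominating_iff[OF G] by blast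
  qed
  have "minimum_edge_dominating G F" if F: "minimal_edge_dominating G F" for F
  proof -
    have dom: "edge_dominating G F" and min: "\<And>F'. F' \<subset> F \<Longrightarrow> \<not> edge_dominating G F'"
      using F by (auto simp: minimal_edge_dominating_def)
    obtain T where T: "T \<subseteq> F" "card T = 2"
      using dominating_card[OF dom] by (meson obtain_subset_with_card_n)
    then obtain e f where ef: "T = {e, f}" "e \<noteq> f" by (auto simp: card_2_iff)
    have "edge_dominating G T"
      using two_dominate[of e f] T dom ef by (auto simp: edge_dominating_def)
    with min T have "F = T" by blast
    with T(2) dom dominating_card show ?thesis by (auto simp: minimum_edge_dominating_def)
  qed
  then show ?thesis by (simp add: well_edge_dominated_def)
qed

section \<open>The characterization\<close>

theorem theorem1p2:
  fixes G :: "'a ugraph" and H :: "'b ugraph"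
  assumes "simple_graph G" and "simple_graph H"
    and "nontrivial G" and "nontrivial H"
    and "connected_graph G" and "connected_graph H"
  shows "well_edge_dominated (G \<boxtimes> H) \<longleftrightarrow> G \<simeq> K2 \<and> H \<simeq> K2"
proof -
  note G = assms(1,3,5) and H = assms(2,4,6)
  obtain a b where ab: "vertex_adj G a b" using nontrivial_connected_graph_has_edge[OF G(2,3)] by blast
  obtain c d where cd: "vertex_adj H c d" using nontrivial_connected_graph_has_edge[OF H(2,3)] by blast
  have "well_edge_dominated (G \<boxtimes> H) \<longleftrightarrow> card (verts G) = 2 \<and> card (verts H) = 2"
  proof
    assume wed: "well_edge_dominated (G \<boxtimes> H)"
    show "card (verts G) = 2 \<and> card (verts H) = 2"
      using wed connected_graph_has_path[OF G] connected_graph_has_path[OF H]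
        strong_product_path_edge_not_well_edge_dominated[OF G(1) H(1) _ _ _ cd]
        strong_product_edge_path_not_well_edge_dominated[OF G(1) H(1) _ _ _ ab] by blast
  next
    assume card: "card (verts G) = 2 \<and> card (verts H) = 2"
    have V: "verts G = {a, b}"
      using card_subset_eq[of "verts G" "{a, b}"] vertex_adjD[OF G(1) ab] card G(1)
      by (auto simp: simple_graph_def)
    have W: "verts H = {c, d}"
      using card_subset_eq[of "verts H" "{c, d}"] vertex_adjD[OF H(1) cd] card H(1)
      by (auto simp: simple_graph_def)
    show "well_edge_dominated (G \<boxtimes> H)"
    proof (rule complete_four_well_edge_dominated)
      show "simple_graph (G \<boxtimes> H)" using G(1) H(1) by (rule simple_graph_strong_product)
      show "card (verts (G \<boxtimes> H)) = 4"
        using card by (simp add: strong_product_def card_cartesian_product)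
      fix p q assume pq: "p \<in> verts (G \<boxtimes> H)" "q \<in> verts (G \<boxtimes> H)" "p \<noteq> q"
      obtain u1 v1 u2 v2 where eq: "p = (u1, v1)" "q = (u2, v2)" by (cases p, cases q)
      have mem: "u1 \<in> {a, b}" "u2 \<in> {a, b}" "v1 \<in> {c, d}" "v2 \<in> {c, d}"
        using pq by (auto simp: eq strong_product_def V W)
      have "(u1 = u2 \<and> u1 \<in> verts G) \<or> vertex_adj G u1 u2"
        using mem ab vertex_adj_sym[of G a b] by (auto simp: V)
      moreover have "(v1 = v2 \<and> v1 \<in> verts H) \<or> vertex_adj H v1 v2"
        using mem cd vertex_adj_sym[of H c d] by (auto simp: W)
      ultimately show "{p, q} \<in> edges (G \<boxtimes> H)"
        using strong_product_edgeI[OF G(1) H(1)] pq(3) by (simp add: eq)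
    qed
  qed
  then show ?thesis by (simp add: isomorphic_K2_iff[OF G] isomorphic_K2_iff[OF H])
qed

end
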